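(* Let $U$ be a non-empty set and let $z,r,e\subseteq U\times U$ be pairwise distinct binary relations on $U$ satisfying $r;e=r=e;r$, $r;r=r$, $z;r=z=r;z$, and $r\cap e=z$, where $a;b=\{(x,y): \exists w\in U,\ (x,w)\in a,\ (w,y)\in b\}$ denotes relational composition. Then $U$ is infinite. *)

theory Defs
  imports Main
begin

end

theory Submission
  imports Defs
begin

text \<open>
  On a finite set an idempotent relation \<open>r\<close> factors through its reflexive points.
  If \<open>w\<close> is such a point, then \<open>r O e = r\<close> and \<open>e O r = r\<close> give some \<open>u\<close> with
  \<open>(w, u) \<in> r \<inter> e = z\<close> and \<open>(u, w) \<in> r\<close>, so that \<open>(w, w) \<in> z\<close>. Since \<open>z\<close> absorbs \<open>r\<close>
  on both sides, this forces \<open>r \<subseteq> z\<close>.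
\<close>

text \<open>Without such a point, \<open>r\<close> is a strict order on the points between
  \<open>x\<close> and \<open>y\<close>. Finiteness then gives a minimal one, while density,
  \<open>r \<subseteq> r O r\<close>, puts another below it.\<close>

lemma idempotent_finite_reflexive_point:
  assumes fin: "finite r" and idem: "r O r = r" and xy: "(x, y) \<in> r"
  shows "\<exists>w. (x, w) \<in> r \<and> (w, w) \<in> r \<and> (w, y) \<in> r"
proof (rule ccontr)
  assume no: "\<not> ?thesis"
  define S where "S = {w. (x, w) \<in> r \<and> (w, y) \<in> r}"
  have tr: "trans r"
    using idem by (auto simp: trans_def)
  have irr: "(w, w) \<notin> r" if "w \<in> S" for w
    using no that unfolding S_def by blast
  have "trans (r \<inter> S \<times> S)"
    using tr unfolding trans_def by blast
  then have "acyclic (r \<inter> S \<times> S)"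
    using irr by (auto simp: acyclic_def trancl_id)
  then have wf: "wf (r \<inter> S \<times> S)"
    using fin by (intro finite_acyclic_wf) auto
  obtain s where "s \<in> S"
    using xy idem unfolding S_def by blast
  then obtain w where w: "w \<in> S" and min: "\<And>v. (v, w) \<in> r \<inter> S \<times> S \<Longrightarrow> v \<notin> S"
    using wf by (meson wfE_min)
  \<comment> \<open>Density is applied to \<open>(x, w)\<close>, the pair on the \<open>x\<close>
    side, so that \<open>v\<close> precedes the minimal \<open>w\<close>.\<close>
  then obtain v where "(x, v) \<in> r" "(v, w) \<in> r"
    using idem unfolding S_def by blast
  moreover from this w have "v \<in> S"
    using tr unfolding S_def trans_def by blast
  ultimately show False
    using w min by blast
qed

theorem theorem2:
  fixes U :: "'a set" and z r e :: "('a \<times> 'a) set"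
  assumes "U \<noteq> {}"
    and "z \<subseteq> U \<times> U" and "r \<subseteq> U \<times> U" and "e \<subseteq> U \<times> U"
    and "z \<noteq> r" and "z \<noteq> e" and "r \<noteq> e"
    and "r O e = r" and "e O r = r"
    and "r O r = r"
    and "z O r = z" and "r O z = z"
    and "r \<inter> e = z"
  shows "infinite U"
proof
  assume "finite U"
  with \<open>r \<subseteq> U \<times> U\<close> have fin: "finite r"
    by (meson finite_SigmaI finite_subset)
  have refl_z: "(w, w) \<in> z" if w: "(w, w) \<in> r" for w
  proof -
    obtain u where u: "(w, u) \<in> e" "(u, w) \<in> r"
      using w \<open>e O r = r\<close> by blast
    \<comment> \<open>The loop at \<open>w\<close> followed by the \<open>e\<close>-edge lies in
      \<open>r O e\<close>.\<close>
    then have "(w, u) \<in> r"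
      using w \<open>r O e = r\<close> by blast
    then show ?thesis
      using u \<open>r \<inter> e = z\<close> \<open>z O r = z\<close> by blast
  qed
  have "r \<subseteq> z"
  proof (rule subrelI)
    fix x y assume "(x, y) \<in> r"
    then obtain w where "(x, w) \<in> r" "(w, w) \<in> r" "(w, y) \<in> r"
      using idempotent_finite_reflexive_point[OF fin \<open>r O r = r\<close>] by metis
    then show "(x, y) \<in> z"
      using refl_z \<open>z O r = z\<close> \<open>r O z = z\<close> by blast
  qed
  then show False
    using \<open>r \<inter> e = z\<close> \<open>z \<noteq> r\<close> by blast
qed

end
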